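(* Let $(X,d)$ be a metric space, $f:X\to(-\infty,\infty]$, $K\in\mathbb{R}$, $N<0$, $f_N:=e^{-f/N}$, and let $\xi:[0,T)\to X$ be an $\mathrm{EVI}_{K,N}$-gradient curve of $f$ which is locally Lipschitz on $(0,T)$. Then the following hold: (i) We have $$\frac{f_N(z)}{f_N(\xi(t))}\ge1+\frac{2K}{N(e^{Kt}-1)}\,\mathfrak{s}_{K/N}\left(\frac{d(\xi(0),z)}{2}\right)^2$$ for all $z\in X$ with $f(z)<\infty$ and all $t\in(0,T)$, with $\sup_{s\in[0,t]}d(\xi(s),z)<\pi\sqrt{N/K}$ if $K<0$. (ii) If $f$ is bounded below, then $$\mathfrak{s}_{K/N}\left(\frac{d(\xi(t_0),\xi(t_1))}{2}\right)^2\le\frac{N(1-e^{K(t_0-t_1)})}{2K}\left\{1-\frac{f_N(\xi(t_0))}{\inf_Xf_N}\right\}$$ for all $0<t_0\le t_1<T$, with $\sup_{t\in[t_0,t_1]}d(\xi(t),\xi(t_0))<\pi\sqrt{N/K}$ if $K<0$. When $K=0$, $K/(e^{Kt}-1)$ is read as $1/t$ and $(1-e^{K(t_0-t_1)})/K$ is read as $t_1-t_0$.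
   Context: For $\kappa\in\mathbb{R}$ and $\theta\ge0$: $\mathfrak{s}_\kappa(\theta)=\frac{1}{\sqrt{\kappa}}\sin(\sqrt{\kappa}\theta)$ if $\kappa>0$; $\mathfrak{s}_0(\theta)=\theta$; $\mathfrak{s}_\kappa(\theta)=\frac{1}{\sqrt{-\kappa}}\sinh(\sqrt{-\kappa}\theta)$ if $\kappa<0$. $\mathcal{D}[f]=\{x\in X: f(x)<\infty\}$. A curve $\xi:I\to X$ is absolutely continuous if there is $h\in L^1_{\mathrm{loc}}(I)$ with $d(\xi(s),\xi(t))\le\int_s^th(r)\,dr$ for all $s<t$ in $I$. $\mathrm{EVI}_{K,N}$-gradient curve: a continuous curve $\xi:[0,T)\to X$, absolutely continuous on $(0,T)$, with $f(\xi(t))<\infty$ for $t\in(0,T)$, such that $$\frac{d}{dt}\left[\mathfrak{s}_{K/N}\left(\frac{d(\xi(t),z)}{2}\right)^2\right]+K\,\mathfrak{s}_{K/N}\left(\frac{d(\xi(t),z)}{2}\right)^2\le\frac{N}{2}\left\{1-\frac{f_N(z)}{f_N(\xi(t))}\right\}$$ holds for all $z\in\mathcal{D}[f]$ and almost all $t\in(0,T)$ with $d(\xi(t),z)<\pi\sqrt{N/K}$ if $K<0$.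
   Formalization: Part (i) is proved under the added assumption that f is lower semicontinuous; without it (i) fails, e.g. X=ℝ, K=0, N=-1, ξ(t)=-t, f(x)=x except f(-1)=5, at z=0, t=1. Part (ii) has no added assumption. *)

theory Defs
  imports "HOL-Analysis.Analysis"
begin

definition s_fun :: "real \<Rightarrow> real \<Rightarrow> real" where
  "s_fun \<kappa> \<theta> =
     (if \<kappa> > 0 then sin (sqrt \<kappa> * \<theta>) / sqrt \<kappa>
      else if \<kappa> = 0 then \<theta>
      else sinh (sqrt (- \<kappa>) * \<theta>) / sqrt (- \<kappa>))"

text \<open>A function with values in the half-open interval from minus infinity (excluded) to
  infinity (included) is a function into \<^typ>\<open>ereal\<close> that omits the value \<open>-\<infinity>\<close>.\<close>

definition domain_of :: "('a \<Rightarrow> ereal) \<Rightarrow> 'a set" where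
  "domain_of f = {x. f x < \<infinity>}"

fun exp_ext :: "ereal \<Rightarrow> ereal" where
  "exp_ext (ereal r) = ereal (exp r)"
| "exp_ext PInfty = \<infinity>"
| "exp_ext MInfty = 0"

text \<open>For \<open>N < 0\<close> the arithmetic of \<^typ>\<open>ereal\<close> gives \<open>f_N = \<infinity>\<close> exactly where \<open>f = \<infinity>\<close>.\<close>

definition f_N :: "('a \<Rightarrow> ereal) \<Rightarrow> real \<Rightarrow> 'a \<Rightarrow> ereal" where
  "f_N f N x = exp_ext (- f x / ereal N)"

definition bounded_below :: "('a \<Rightarrow> ereal) \<Rightarrow> bool" where
  "bounded_below f \<longleftrightarrow> (\<exists>m::real. \<forall>x. ereal m \<le> f x)"

text \<open>Without lower semicontinuity the pointwise lower bound for \<open>f_N z / f_N (\<xi> t)\<close> at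
  \<^emph>\<open>every\<close> time \<open>t\<close> fails: raising the value of \<open>f\<close> at a single point of the curve
  preserves the almost-everywhere inequality of an EVI-gradient curve, but not that bound. For
  example take \<open>K = 0\<close>, \<open>N = -1\<close>, \<open>\<xi> t = - t\<close> in the real line and \<open>f x = x\<close> except
  \<open>f (-1) = 5\<close>.\<close>

definition lower_semicontinuous :: "('a::topological_space \<Rightarrow> ereal) \<Rightarrow> bool" where
  "lower_semicontinuous f \<longleftrightarrow> (\<forall>x. f x \<le> Liminf (at x) f)"

definition absolutely_continuous_curve :: "real set \<Rightarrow> (real \<Rightarrow> 'a::metric_space) \<Rightarrow> bool" where
  "absolutely_continuous_curve I \<xi> \<longleftrightarrow>
     (\<exists>h::real \<Rightarrow> real.
        (\<forall>C. compact C \<and> C \<subseteq> I \<longrightarrow> set_integrable lebesgue C h) \<and>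
        (\<forall>s\<in>I. \<forall>t\<in>I. s < t \<longrightarrow> dist (\<xi> s) (\<xi> t) \<le> set_lebesgue_integral lebesgue {s..t} h))"

definition locally_lipschitz_on :: "real set \<Rightarrow> (real \<Rightarrow> 'a::metric_space) \<Rightarrow> bool" where
  "locally_lipschitz_on I \<xi> \<longleftrightarrow>
     (\<forall>t\<in>I. \<exists>\<epsilon>>0. \<exists>L. L-lipschitz_on (I \<inter> ball t \<epsilon>) \<xi>)"

text \<open>A curve on \<open>[0,T)\<close>, where \<open>T = \<infinity>\<close> is allowed, is a function on \<^typ>\<open>real\<close> of
  which only the values on \<open>[0,T)\<close> matter. The exceptional null set of times may depend on \<open>z\<close>,
  and the differential inequality at \<open>t\<close> includes the existence of the derivative at \<open>t\<close>.\<close>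

definition EVI_gradient_curve ::
  "real \<Rightarrow> real \<Rightarrow> ('a::metric_space \<Rightarrow> ereal) \<Rightarrow> ereal \<Rightarrow> (real \<Rightarrow> 'a) \<Rightarrow> bool" where
  "EVI_gradient_curve K N f T \<xi> \<longleftrightarrow>
     continuous_on {t. 0 \<le> t \<and> ereal t < T} \<xi> \<and>
     absolutely_continuous_curve {t. 0 < t \<and> ereal t < T} \<xi> \<and>
     (\<forall>t. 0 < t \<and> ereal t < T \<longrightarrow> f (\<xi> t) < \<infinity>) \<and>
     (\<forall>z\<in>domain_of f. AE t in lebesgue.
        0 < t \<and> ereal t < T \<and> (K < 0 \<longrightarrow> dist (\<xi> t) z < pi * sqrt (N / K)) \<longrightarrow>
        (\<exists>D. ((\<lambda>r. (s_fun (K / N) (dist (\<xi> r) z / 2))\<^sup>2) has_real_derivative D) (at t) \<and>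
             ereal (D + K * (s_fun (K / N) (dist (\<xi> t) z / 2))\<^sup>2)
               \<le> ereal (N / 2) * (1 - f_N f N z / f_N f N (\<xi> t))))"

end

theory Submission
  imports Defs
begin

text \<open>
  Write \<open>u t\<close> for the squared value of \<open>s_fun (K / N)\<close> at half the distance from \<open>\<xi> t\<close> to a fixed
  point \<open>z\<close>. The evolution variational inequality says
  \<open>(exp (K t) u)' \<le> (N / 2) exp (K t) (1 - f_N z / f_N (\<xi> t))\<close> for almost every \<open>t\<close>. If the factor
  \<open>(N / 2) (1 - f_N z / f_N (\<xi> t))\<close> is at most a constant \<open>C\<close> on an interval, the inequality can be
  integrated over it, with \<open>C\<close> times the increment of a primitive of \<open>exp (K t)\<close> on the right
  (\<open>EVI_integrated\<close>). Only constant bounds are ever inserted, so the integrability of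
  \<open>1 / f_N (\<xi> t)\<close> is never in question. Both parts of the theorem, and the monotonicity that the
  first one rests on, are instances with different choices of \<open>z\<close> and \<open>C\<close>.

  Integrating an almost-everywhere inequality requires that \<open>u\<close> does not grow on a null set.
  This is where the Lipschitz hypothesis enters: a locally Lipschitz function maps null sets to null
  sets, so if \<open>F\<close> increased over an interval, some value between its end values would be attained
  for the last time at a point where the derivative exists and has the prescribed sign, which is
  absurd (\<open>AE_deriv_neg_imp_le\<close>).

  For the distance bound take \<open>z = \<xi> t0\<close>, so that \<open>u\<close> vanishes at \<open>t0\<close>, and bound \<open>f_N (\<xi> t)\<close> from
  below by its infimum, which a lower bound of \<open>f\<close> makes positive.

  For the lower bound of \<open>f_N z / f_N (\<xi> t)\<close> one bounds \<open>f_N (\<xi> s)\<close> from below by \<open>f_N (\<xi> t)\<close> for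
  \<open>s \<le> t\<close>, and drops the nonnegative term \<open>exp (K t) u t\<close>. This uses that \<open>f\<close> does not increase along the
  curve (\<open>f_antimono_along_EVI_curve\<close>). If it did not, lower semicontinuity would give a last time
  \<open>c\<close> in some interval at which \<open>f (\<xi> c)\<close> does not exceed the initial value, and \<open>f (\<xi> t) > f (\<xi> c)\<close>
  for all later times of that interval. With \<open>z = \<xi> c\<close> the right side of the inequality is then
  negative just after \<open>c\<close>, while \<open>u\<close> starts at \<open>0\<close>; so \<open>u\<close> remains \<open>0\<close>, its derivative is
  \<open>0\<close>, and the inequality is violated.
\<close>

section \<open>Pointwise Lipschitz functions\<close>

text \<open>A Lipschitz bound from each single point suffices for null sets to be mapped to null sets,
  and, unlike a Lipschitz bound on a neighbourhood, it follows from mere differentiability.\<close>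

definition pointwise_lipschitz :: "(real \<Rightarrow> real) \<Rightarrow> real \<Rightarrow> bool" where
  "pointwise_lipschitz F x \<longleftrightarrow>
     (\<exists>B. \<forall>\<^sub>F y in nhds x. \<bar>F y - F x\<bar> \<le> B * \<bar>y - x\<bar>)"

lemma pointwise_lipschitzI:
  assumes "\<forall>\<^sub>F y in nhds x. \<bar>F y - F x\<bar> \<le> B * \<bar>y - x\<bar>"
  shows "pointwise_lipschitz F x"
  using assms unfolding pointwise_lipschitz_def by blast

lemma pointwise_lipschitz_nonneg_constant:
  assumes "pointwise_lipschitz F x"
  obtains B where "B \<ge> 0" "\<forall>\<^sub>F y in nhds x. \<bar>F y - F x\<bar> \<le> B * \<bar>y - x\<bar>"
proof -
  obtain B where B: "\<forall>\<^sub>F y in nhds x. \<bar>F y - F x\<bar> \<le> B * \<bar>y - x\<bar>"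
    using assms unfolding pointwise_lipschitz_def by blast
  have le: "B * \<bar>y - x\<bar> \<le> \<bar>B\<bar> * \<bar>y - x\<bar>" for y
    by (intro mult_right_mono) auto
  have "\<forall>\<^sub>F y in nhds x. \<bar>F y - F x\<bar> \<le> \<bar>B\<bar> * \<bar>y - x\<bar>"
    by (rule eventually_mono[OF B]) (use le order_trans in blast)
  then show ?thesis using that[of "\<bar>B\<bar>"] by simp
qed

lemma pointwise_lipschitz_tendsto:
  assumes "pointwise_lipschitz F x"
  shows "(F \<longlongrightarrow> F x) (nhds x)"
proof -
  obtain B where B: "\<forall>\<^sub>F y in nhds x. \<bar>F y - F x\<bar> \<le> B * \<bar>y - x\<bar>"
    using assms unfolding pointwise_lipschitz_def by blast
  have "isCont (\<lambda>y. B * \<bar>y - x\<bar>) x"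
    by (intro continuous_intros)
  then have "((\<lambda>y. B * \<bar>y - x\<bar>) \<longlongrightarrow> 0) (nhds x)"
    using tendsto_at_iff_tendsto_nhds[of "\<lambda>y. B * \<bar>y - x\<bar>" x] by (simp add: isCont_def)
  with B have "((\<lambda>y. F y - F x) \<longlongrightarrow> 0) (nhds x)"
    unfolding real_norm_def[symmetric] by (rule Lim_null_comparison)
  then show ?thesis by (rule LIM_zero_cancel)
qed

lemma has_real_derivative_imp_pointwise_lipschitz:
  assumes "(F has_real_derivative D) (at x)"
  shows "pointwise_lipschitz F x"
proof -
  have "((\<lambda>y. \<bar>(F y - F x) / (y - x)\<bar>) \<longlongrightarrow> \<bar>D\<bar>) (at x)"
    using assms unfolding has_field_derivative_iff by (rule tendsto_rabs)
  then have "\<forall>\<^sub>F y in at x. \<bar>(F y - F x) / (y - x)\<bar> < \<bar>D\<bar> + 1"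
    by (rule order_tendstoD) simp
  then have "\<forall>\<^sub>F y in at x. \<bar>F y - F x\<bar> \<le> (\<bar>D\<bar> + 1) * \<bar>y - x\<bar>"
    by (rule eventually_mono[OF eventually_conj[OF eventually_neq_at_within[of x x UNIV]]])
       (auto simp: abs_divide divide_simps split: if_splits)
  then have "\<forall>\<^sub>F y in nhds x. y \<noteq> x \<longrightarrow> \<bar>F y - F x\<bar> \<le> (\<bar>D\<bar> + 1) * \<bar>y - x\<bar>"
    by (simp add: eventually_at_filter)
  then show ?thesis
    by (intro pointwise_lipschitzI[where B = "\<bar>D\<bar> + 1"]) (erule eventually_mono, auto)
qed

lemma pointwise_lipschitz_compose:
  assumes F: "pointwise_lipschitz F x" and G: "pointwise_lipschitz G (F x)"
  shows "pointwise_lipschitz (\<lambda>y. G (F y)) x"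
proof -
  obtain B where B: "\<forall>\<^sub>F y in nhds x. \<bar>F y - F x\<bar> \<le> B * \<bar>y - x\<bar>"
    using F unfolding pointwise_lipschitz_def by blast
  obtain C where C: "C \<ge> 0" "\<forall>\<^sub>F w in nhds (F x). \<bar>G w - G (F x)\<bar> \<le> C * \<bar>w - F x\<bar>"
    using pointwise_lipschitz_nonneg_constant[OF G] .
  have "\<forall>\<^sub>F y in nhds x. \<bar>G (F y) - G (F x)\<bar> \<le> C * \<bar>F y - F x\<bar>"
    using C(2) pointwise_lipschitz_tendsto[OF F] by (rule eventually_compose_filterlim)
  with B have "\<forall>\<^sub>F y in nhds x. \<bar>G (F y) - G (F x)\<bar> \<le> (C * B) * \<bar>y - x\<bar>"
  proof eventually_elim
    case (elim y)
    have "C * \<bar>F y - F x\<bar> \<le> C * (B * \<bar>y - x\<bar>)" using elim(1) C(1) by (rule mult_left_mono)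
    with elim(2) show ?case by (simp add: mult.assoc)
  qed
  then show ?thesis by (rule pointwise_lipschitzI)
qed

lemma pointwise_lipschitz_diff:
  assumes F: "pointwise_lipschitz F x" and G: "pointwise_lipschitz G x"
  shows "pointwise_lipschitz (\<lambda>y. F y - G y) x"
proof -
  obtain B where B: "\<forall>\<^sub>F y in nhds x. \<bar>F y - F x\<bar> \<le> B * \<bar>y - x\<bar>"
    using F unfolding pointwise_lipschitz_def by blast
  obtain C where C: "\<forall>\<^sub>F y in nhds x. \<bar>G y - G x\<bar> \<le> C * \<bar>y - x\<bar>"
    using G unfolding pointwise_lipschitz_def by blast
  from B C have "\<forall>\<^sub>F y in nhds x. \<bar>(F y - G y) - (F x - G x)\<bar> \<le> (B + C) * \<bar>y - x\<bar>"
    by eventually_elim (simp add: distrib_right)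
  then show ?thesis by (rule pointwise_lipschitzI)
qed

lemma pointwise_lipschitz_mult:
  assumes F: "pointwise_lipschitz F x" and G: "pointwise_lipschitz G x"
  shows "pointwise_lipschitz (\<lambda>y. F y * G y) x"
proof -
  obtain B where B: "B \<ge> 0" "\<forall>\<^sub>F y in nhds x. \<bar>F y - F x\<bar> \<le> B * \<bar>y - x\<bar>"
    using pointwise_lipschitz_nonneg_constant[OF F] .
  obtain C where C: "C \<ge> 0" "\<forall>\<^sub>F y in nhds x. \<bar>G y - G x\<bar> \<le> C * \<bar>y - x\<bar>"
    using pointwise_lipschitz_nonneg_constant[OF G] .
  have "((\<lambda>y. \<bar>F y\<bar>) \<longlongrightarrow> \<bar>F x\<bar>) (nhds x)"
    using pointwise_lipschitz_tendsto[OF F] by (rule tendsto_rabs)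
  then have "\<forall>\<^sub>F y in nhds x. \<bar>F y\<bar> < \<bar>F x\<bar> + 1"
    by (rule order_tendstoD) simp
  with B(2) C(2)
  have "\<forall>\<^sub>F y in nhds x. \<bar>F y * G y - F x * G x\<bar> \<le> ((\<bar>F x\<bar> + 1) * C + B * \<bar>G x\<bar>) * \<bar>y - x\<bar>"
  proof eventually_elim
    case (elim y)
    have "F y * G y - F x * G x = F y * (G y - G x) + (F y - F x) * G x"
      by (simp add: algebra_simps)
    then have "\<bar>F y * G y - F x * G x\<bar> \<le> \<bar>F y\<bar> * \<bar>G y - G x\<bar> + \<bar>F y - F x\<bar> * \<bar>G x\<bar>"
      by (metis abs_mult abs_triangle_ineq)
    also have "\<dots> \<le> (\<bar>F x\<bar> + 1) * (C * \<bar>y - x\<bar>) + (B * \<bar>y - x\<bar>) * \<bar>G x\<bar>"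
      using elim by (intro add_mono mult_mono) auto
    finally show ?case by (simp add: algebra_simps)
  qed
  then show ?thesis by (rule pointwise_lipschitzI)
qed

section \<open>Monotonicity from almost-everywhere derivative bounds\<close>

lemma AE_lebesgue_negligible:
  assumes "AE t::real in lebesgue. P t"
  shows "negligible {t. \<not> P t}"
proof -
  have "\<exists>N. negligible N \<and> {t. \<not> P t} \<subseteq> N"
    by (rule iffD1[OF eventually_ae_filter_negligible assms])
  then show ?thesis by (meson negligible_subset)
qed

lemma not_interval_subset_negligible:
  assumes "negligible (N :: real set)" "a < b"
  shows "\<not> {a<..<b} \<subseteq> N"
proof
  assume "{a<..<b} \<subseteq> N"
  then have "negligible (box a b)" using assms(1) negligible_subset by auto
  then have "box a b = {}" by (simp only: negligible_interval)
  then show False using assms(2) by simp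
qed

lemma AE_lebesgue_obtain:
  assumes "AE t::real in lebesgue. P t" "a < b"
  obtains t where "a < t" "t < b" "P t"
proof -
  have "\<not> {a<..<b} \<subseteq> {t. \<not> P t}"
    using AE_lebesgue_negligible[OF assms(1)] assms(2) by (rule not_interval_subset_negligible)
  then show ?thesis using that by force
qed

text \<open>The exceptional set \<open>E\<close> is null, and so is its image. If \<open>F a < F b\<close>, some value \<open>v\<close> strictly
  between them is missed by \<open>F\<close> on \<open>E\<close>. At the last time \<open>c\<close> with \<open>F c \<le> v\<close> one has \<open>F c = v\<close>, so
  \<open>c\<close> is not exceptional and \<open>F\<close> falls below \<open>v\<close> just after \<open>c\<close>, contrary to the choice of \<open>c\<close>.\<close>

lemma AE_deriv_neg_imp_le:
  fixes F :: "real \<Rightarrow> real"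
  assumes ab: "a \<le> b" and cont: "continuous_on {a..b} F"
    and lip: "\<And>t. a < t \<Longrightarrow> t < b \<Longrightarrow> pointwise_lipschitz F t"
    and deriv: "AE t in lebesgue. a < t \<and> t < b \<longrightarrow> (\<exists>D<0. (F has_real_derivative D) (at t))"
  shows "F b \<le> F a"
proof (rule ccontr)
  assume "\<not> F b \<le> F a"
  then have lt: "F a < F b" by simp
  define E where "E = {t. \<not> (a < t \<and> t < b \<longrightarrow> (\<exists>D<0. (F has_real_derivative D) (at t)))}"
  have "negligible E"
    using AE_lebesgue_negligible[OF deriv] unfolding E_def .
  then have "negligible (F ` E)"
  proof (rule negligible_locally_Lipschitz_image[rotated])
    fix x assume "x \<in> E"
    then have "pointwise_lipschitz F x" using lip by (auto simp: E_def)
    then show "\<exists>U B. open U \<and> x \<in> U \<and> (\<forall>y \<in> E \<inter> U. norm (F y - F x) \<le> B * norm (y - x))"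
      unfolding pointwise_lipschitz_def eventually_nhds real_norm_def by blast
  qed simp
  then have "\<not> {F a<..<F b} \<subseteq> F ` E"
    using lt by (rule not_interval_subset_negligible)
  then obtain v where v: "F a < v" "v < F b" "v \<notin> F ` E"
    by (meson greaterThanLessThan_iff subsetI)
  define S where "S = {t \<in> {a..b}. F t \<le> v}"
  have "closed S" unfolding S_def
    by (rule continuous_on_closed_Collect_le[OF cont continuous_on_const closed_atLeastAtMost])
  moreover have "bounded S" by (rule bounded_subset[of "{a..b}"]) (auto simp: S_def)
  moreover have "a \<in> S" using ab v by (auto simp: S_def)
  ultimately obtain c where c: "c \<in> S" "\<And>t. t \<in> S \<Longrightarrow> t \<le> c"
    using compact_attains_sup[of S] by (auto simp: compact_eq_bounded_closed)
  have above: "v < F t" if "c < t" "t \<le> b" for t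
    using c(1) c(2)[of t] that by (cases "v < F t") (auto simp: S_def)
  have "c < b" using c v by (cases "c = b") (auto simp: S_def)
  have "F c = v"
  proof (rule ccontr)
    assume "F c \<noteq> v"
    then have "F c < v" using c by (auto simp: S_def)
    then obtain t where "c \<le> t" "t \<le> b" "F t = v"
      using IVT'[of F c v b] \<open>c < b\<close> v c continuous_on_subset[OF cont]
      by (force simp: S_def)
    then show False using above[of t] \<open>F c < v\<close> by (cases "t = c") auto
  qed
  then have "a < c" using c v by (cases "a = c") (auto simp: S_def)
  moreover have "c \<notin> E" using v \<open>F c = v\<close> by auto
  ultimately obtain D where "D < 0" "(F has_real_derivative D) (at c)"
    using \<open>c < b\<close> by (auto simp: E_def)
  then obtain d where d: "d > 0" "\<And>h. 0 < h \<Longrightarrow> h < d \<Longrightarrow> F (c + h) < F c"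
    using DERIV_neg_dec_right by blast
  define h where "h = min (d / 2) (b - c)"
  have "F (c + h) < F c" using d \<open>c < b\<close> by (intro d(2)) (auto simp: h_def)
  moreover have "v < F (c + h)" using d \<open>c < b\<close> by (intro above) (auto simp: h_def)
  ultimately show False using \<open>F c = v\<close> by simp
qed

text \<open>A small linear term makes the derivative strictly negative.\<close>

lemma AE_deriv_nonpos_imp_le:
  fixes F :: "real \<Rightarrow> real"
  assumes ab: "a \<le> b" and cont: "continuous_on {a..b} F"
    and lip: "\<And>t. a < t \<Longrightarrow> t < b \<Longrightarrow> pointwise_lipschitz F t"
    and deriv: "AE t in lebesgue. a < t \<and> t < b \<longrightarrow> (\<exists>D\<le>0. (F has_real_derivative D) (at t))"
  shows "F b \<le> F a"
proof -
  have "F b - e * b \<le> F a - e * a" if e: "e > 0" for e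
  proof (rule AE_deriv_neg_imp_le[where F = "\<lambda>t. F t - e * t", OF ab])
    show "continuous_on {a..b} (\<lambda>t. F t - e * t)" by (intro continuous_intros cont)
    have "((\<lambda>t. e * t) has_real_derivative e) (at t)" for t
      by (auto intro!: derivative_eq_intros)
    then show "pointwise_lipschitz (\<lambda>t. F t - e * t) t" if "a < t" "t < b" for t
      by (intro pointwise_lipschitz_diff lip[OF that])
        (rule has_real_derivative_imp_pointwise_lipschitz)
    show "AE t in lebesgue. a < t \<and> t < b \<longrightarrow>
            (\<exists>D<0. ((\<lambda>t. F t - e * t) has_real_derivative D) (at t))"
      using deriv
    proof eventually_elim
      case (elim t)
      show ?case
      proof
        assume "a < t \<and> t < b"
        then obtain D where D: "D \<le> 0" "(F has_real_derivative D) (at t)" using elim by auto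
        have "((\<lambda>t. F t - e * t) has_real_derivative D - e) (at t)"
          using D(2) by (auto intro!: derivative_eq_intros)
        then show "\<exists>D<0. ((\<lambda>t. F t - e * t) has_real_derivative D) (at t)"
          using D(1) e by (intro exI[of _ "D - e"]) auto
      qed
    qed
  qed
  then have *: "F b - F a \<le> e * (b - a)" if "e > 0" for e
    using that by (force simp: algebra_simps)
  show ?thesis
  proof (rule ccontr)
    assume "\<not> F b \<le> F a"
    then have lt: "F a < F b" by simp
    then have "a < b" using ab by (cases "a = b") auto
    have "F b - F a \<le> (F b - F a) / (2 * (b - a)) * (b - a)"
      using lt \<open>a < b\<close> by (intro *) simp
    also have "\<dots> = (F b - F a) / 2" using \<open>a < b\<close> by (simp add: divide_simps)
    finally show False using lt by simp
  qed
qed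

text \<open>A primitive of \<open>exp (K t)\<close> that covers the degenerate case \<open>K = 0\<close>, so that the two readings
  of the constants in the theorem need no separate treatment.\<close>

definition exp_primitive :: "real \<Rightarrow> real \<Rightarrow> real" where
  "exp_primitive K t = (if K = 0 then t else exp (K * t) / K)"

lemma exp_primitive_deriv: "(exp_primitive K has_real_derivative exp (K * t)) (at t)"
proof (cases "K = 0")
  case True
  then have "exp_primitive K = (\<lambda>t. t)" by (auto simp: exp_primitive_def)
  with True show ?thesis by simp
next
  case False
  then have "exp_primitive K = (\<lambda>t. exp (K * t) / K)" by (auto simp: exp_primitive_def)
  with False show ?thesis by (auto intro!: derivative_eq_intros)
qed

text \<open>The integrating factor \<open>exp (K t)\<close> turns the hypothesis into a bound for the derivative of
  \<open>exp (K t) u t - C exp_primitive K t\<close>, which is therefore nonincreasing.\<close>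

lemma AE_gronwall:
  fixes u :: "real \<Rightarrow> real"
  assumes ab: "a \<le> b" and cont: "continuous_on {a..b} u"
    and lip: "\<And>t. a < t \<Longrightarrow> t < b \<Longrightarrow> pointwise_lipschitz u t"
    and deriv: "AE t in lebesgue. a < t \<and> t < b \<longrightarrow>
                  (\<exists>D. (u has_real_derivative D) (at t) \<and> D + K * u t \<le> C)"
  shows "exp (K * b) * u b \<le> exp (K * a) * u a + C * (exp_primitive K b - exp_primitive K a)"
proof -
  define F where "F = (\<lambda>t. exp (K * t) * u t - C * exp_primitive K t)"
  have dexp: "((\<lambda>t. exp (K * t)) has_real_derivative K * exp (K * t)) (at t)" for t
    by (auto intro!: derivative_eq_intros)
  have dprim: "((\<lambda>t. C * exp_primitive K t) has_real_derivative C * exp (K * t)) (at t)" for t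
    by (intro DERIV_cmult exp_primitive_deriv)
  have "F b \<le> F a"
  proof (rule AE_deriv_nonpos_imp_le[OF ab])
    show "continuous_on {a..b} F" unfolding F_def
      using dprim by (intro continuous_intros cont DERIV_continuous_on[where D = "\<lambda>t. C * exp (K * t)"])
        (auto intro: has_field_derivative_at_within)
    show "pointwise_lipschitz F t" if "a < t" "t < b" for t
      unfolding F_def
      by (rule pointwise_lipschitz_diff[OF pointwise_lipschitz_mult[OF
            has_real_derivative_imp_pointwise_lipschitz[OF dexp] lip[OF that]]
            has_real_derivative_imp_pointwise_lipschitz[OF dprim]])
    show "AE t in lebesgue. a < t \<and> t < b \<longrightarrow> (\<exists>D\<le>0. (F has_real_derivative D) (at t))"
      using deriv
    proof eventually_elim
      case (elim t)
      show ?case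
      proof
        assume "a < t \<and> t < b"
        then obtain D where D: "(u has_real_derivative D) (at t)" "D + K * u t \<le> C"
          using elim by auto
        have "(F has_real_derivative exp (K * t) * ((D + K * u t) - C)) (at t)"
          unfolding F_def
          by (rule DERIV_cong[OF DERIV_diff[OF DERIV_mult[OF dexp D(1)] dprim]])
             (simp add: algebra_simps)
        moreover have "exp (K * t) * ((D + K * u t) - C) \<le> 0"
          using D(2) by (simp add: mult_le_0_iff)
        ultimately show "\<exists>D\<le>0. (F has_real_derivative D) (at t)" by blast
      qed
    qed
  qed
  then show ?thesis by (simp add: F_def algebra_simps)
qed


section \<open>The integrated evolution variational inequality\<close>

lemma s_fun_half_sq_deriv:
  obtains D where "((\<lambda>d. (s_fun \<kappa> (d / 2))\<^sup>2) has_real_derivative D) (at d)"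
proof -
  consider "\<kappa> > 0" | "\<kappa> = 0" | "\<kappa> < 0" by linarith
  then have "\<exists>D. (s_fun \<kappa> has_real_derivative D) (at (d / 2))"
  proof cases
    case 1
    then have "s_fun \<kappa> = (\<lambda>\<theta>. sin (sqrt \<kappa> * \<theta>) / sqrt \<kappa>)" by (auto simp: s_fun_def)
    then show ?thesis using 1 by (auto intro!: exI derivative_eq_intros)
  next
    case 2
    then have "s_fun \<kappa> = (\<lambda>\<theta>. \<theta>)" by (auto simp: s_fun_def)
    then show ?thesis using DERIV_ident by metis
  next
    case 3
    then have "s_fun \<kappa> = (\<lambda>\<theta>. sinh (sqrt (- \<kappa>) * \<theta>) / sqrt (- \<kappa>))" by (auto simp: s_fun_def)
    then show ?thesis using 3 by (auto intro!: exI derivative_eq_intros)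
  qed
  then obtain D where "(s_fun \<kappa> has_real_derivative D) (at (d / 2))" ..
  moreover have "((\<lambda>d. d / 2) has_real_derivative 1 / 2) (at d)"
    by (auto intro!: derivative_eq_intros)
  ultimately have "((\<lambda>d. s_fun \<kappa> (d / 2)) has_real_derivative D * (1 / 2)) (at d)"
    by (rule DERIV_chain2)
  from DERIV_power[OF this, of 2] that show thesis by blast
qed

lemma s_fun_0 [simp]: "s_fun \<kappa> 0 = 0"
  by (simp add: s_fun_def)

lemma continuous_on_s_fun_half_sq_dist:
  fixes \<xi> :: "real \<Rightarrow> 'a::metric_space"
  assumes "continuous_on A \<xi>"
  shows "continuous_on A (\<lambda>t. (s_fun \<kappa> (dist (\<xi> t) z / 2))\<^sup>2)"
proof -
  have "isCont (\<lambda>d. (s_fun \<kappa> (d / 2))\<^sup>2) d" for d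
    using s_fun_half_sq_deriv DERIV_isCont by metis
  then have "continuous_on UNIV (\<lambda>d. (s_fun \<kappa> (d / 2))\<^sup>2)"
    by (simp add: continuous_at_imp_continuous_on)
  from continuous_on_compose2[OF this, of A "\<lambda>t. dist (\<xi> t) z"]
  show ?thesis using assms by (simp add: continuous_on_dist continuous_on_const)
qed

text \<open>The distance to \<open>z\<close> is 1-Lipschitz, so it inherits the Lipschitz bound of the curve, and the
  outer function is differentiable.\<close>

lemma pointwise_lipschitz_s_fun_half_sq_dist:
  fixes \<xi> :: "real \<Rightarrow> 'a::metric_space"
  assumes lip: "locally_lipschitz_on I \<xi>" and I: "{a<..<b} \<subseteq> I" and t: "a < t" "t < b"
  shows "pointwise_lipschitz (\<lambda>r. (s_fun \<kappa> (dist (\<xi> r) z / 2))\<^sup>2) t"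
proof -
  obtain \<epsilon> L where \<epsilon>: "\<epsilon> > 0" and L: "L-lipschitz_on (I \<inter> ball t \<epsilon>) \<xi>"
    using lip I t unfolding locally_lipschitz_on_def by (meson greaterThanLessThan_iff subsetD)
  have "\<forall>\<^sub>F r in nhds t. r \<in> {a<..<b} \<inter> ball t \<epsilon>"
    using t \<epsilon> by (intro eventually_nhds_in_open) auto
  then have "\<forall>\<^sub>F r in nhds t. \<bar>dist (\<xi> r) z - dist (\<xi> t) z\<bar> \<le> L * \<bar>r - t\<bar>"
  proof eventually_elim
    case (elim r)
    have "dist (\<xi> r) (\<xi> t) \<le> L * dist r t"
      using elim I t \<epsilon> by (intro lipschitz_onD[OF L]) auto
    moreover have "\<bar>dist (\<xi> r) z - dist (\<xi> t) z\<bar> \<le> dist (\<xi> r) (\<xi> t)"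
      using abs_dist_diff_le[of "\<xi> r" z "\<xi> t"] by (simp add: dist_commute)
    ultimately show ?case by (simp add: dist_real_def)
  qed
  then have "pointwise_lipschitz (\<lambda>r. dist (\<xi> r) z) t" by (rule pointwise_lipschitzI)
  moreover have "pointwise_lipschitz (\<lambda>d. (s_fun \<kappa> (d / 2))\<^sup>2) d" for d
    using s_fun_half_sq_deriv has_real_derivative_imp_pointwise_lipschitz by metis
  ultimately show ?thesis by (rule pointwise_lipschitz_compose)
qed

text \<open>The constant \<open>C\<close> has to dominate the right side of the differential inequality only in the
  open interval. This allows \<open>a = 0\<close>, where the curve is merely continuous and \<open>f (\<xi> 0)\<close> may be
  infinite.\<close>

lemma EVI_integrated:
  fixes \<xi> :: "real \<Rightarrow> 'a::metric_space"
  assumes EVI: "EVI_gradient_curve K N f T \<xi>"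
    and lip: "locally_lipschitz_on {t. 0 < t \<and> ereal t < T} \<xi>"
    and ab: "0 \<le> a" "a \<le> b" "ereal b < T" and z: "f z < \<infinity>"
    and near: "\<And>t. K < 0 \<Longrightarrow> a < t \<Longrightarrow> t < b \<Longrightarrow> dist (\<xi> t) z < pi * sqrt (N / K)"
    and C: "\<And>t. a < t \<Longrightarrow> t < b \<Longrightarrow> ereal (N / 2) * (1 - f_N f N z / f_N f N (\<xi> t)) \<le> ereal C"
  shows "exp (K * b) * (s_fun (K / N) (dist (\<xi> b) z / 2))\<^sup>2
           \<le> exp (K * a) * (s_fun (K / N) (dist (\<xi> a) z / 2))\<^sup>2
              + C * (exp_primitive K b - exp_primitive K a)"
proof (rule AE_gronwall[OF ab(2)])
  have time: "ereal t < T" if "t \<le> b" for t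
    using that ab(3) by (meson ereal_less_eq(3) le_less_trans)
  have "continuous_on {t. 0 \<le> t \<and> ereal t < T} \<xi>"
    using EVI by (simp add: EVI_gradient_curve_def)
  then have "continuous_on {a..b} \<xi>"
    by (rule continuous_on_subset) (use ab time in auto)
  then show "continuous_on {a..b} (\<lambda>t. (s_fun (K / N) (dist (\<xi> t) z / 2))\<^sup>2)"
    by (rule continuous_on_s_fun_half_sq_dist)
  show "pointwise_lipschitz (\<lambda>t. (s_fun (K / N) (dist (\<xi> t) z / 2))\<^sup>2) t" if "a < t" "t < b" for t
    by (rule pointwise_lipschitz_s_fun_half_sq_dist[OF lip _ that]) (use ab time in auto)
  have "AE t in lebesgue.
        0 < t \<and> ereal t < T \<and> (K < 0 \<longrightarrow> dist (\<xi> t) z < pi * sqrt (N / K)) \<longrightarrow>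
        (\<exists>D. ((\<lambda>r. (s_fun (K / N) (dist (\<xi> r) z / 2))\<^sup>2) has_real_derivative D) (at t) \<and>
             ereal (D + K * (s_fun (K / N) (dist (\<xi> t) z / 2))\<^sup>2)
               \<le> ereal (N / 2) * (1 - f_N f N z / f_N f N (\<xi> t)))"
    using EVI z by (auto simp: EVI_gradient_curve_def domain_of_def)
  then show "AE t in lebesgue. a < t \<and> t < b \<longrightarrow>
      (\<exists>D. ((\<lambda>t. (s_fun (K / N) (dist (\<xi> t) z / 2))\<^sup>2) has_real_derivative D) (at t) \<and>
           D + K * (s_fun (K / N) (dist (\<xi> t) z / 2))\<^sup>2 \<le> C)"
  proof eventually_elim
    case (elim t)
    show ?case
    proof
      assume t: "a < t \<and> t < b"
      then obtain D where
        D: "((\<lambda>r. (s_fun (K / N) (dist (\<xi> r) z / 2))\<^sup>2) has_real_derivative D) (at t)"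
        and le: "ereal (D + K * (s_fun (K / N) (dist (\<xi> t) z / 2))\<^sup>2)
               \<le> ereal (N / 2) * (1 - f_N f N z / f_N f N (\<xi> t))"
        using elim near time[of t] ab(1) by auto
      from le C[of t] t have "ereal (D + K * (s_fun (K / N) (dist (\<xi> t) z / 2))\<^sup>2) \<le> ereal C"
        using order_trans by blast
      with D show "\<exists>D. ((\<lambda>t. (s_fun (K / N) (dist (\<xi> t) z / 2))\<^sup>2) has_real_derivative D) (at t) \<and>
           D + K * (s_fun (K / N) (dist (\<xi> t) z / 2))\<^sup>2 \<le> C"
        by auto
    qed
  qed
qed

section \<open>Monotonicity of the function along the curve\<close>

lemma exp_ext_infinity [simp]: "exp_ext \<infinity> = \<infinity>"
  using exp_ext.simps(2) by simp

lemma f_N_finite: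
  assumes "f x \<noteq> - \<infinity>" "f x < \<infinity>" "N \<noteq> 0"
  obtains r where "f x = ereal r" "f_N f N x = ereal (exp (- r / N))"
  using assms by (cases "f x") (auto simp: f_N_def)

lemma closed_sublevel_lower_semicontinuous:
  fixes f :: "'a::topological_space \<Rightarrow> ereal"
  assumes "lower_semicontinuous f"
  shows "closed {x. f x \<le> \<alpha>}"
proof -
  have "\<exists>U. open U \<and> x \<in> U \<and> U \<subseteq> {x. \<alpha> < f x}" if "\<alpha> < f x" for x
  proof -
    have "\<alpha> < Liminf (at x) f"
      using that assms unfolding lower_semicontinuous_def by (metis less_le_trans)
    then have "\<forall>\<^sub>F y in at x. \<alpha> < f y" by (rule less_LiminfD)
    then have *: "\<forall>\<^sub>F y in nhds x. y \<noteq> x \<longrightarrow> \<alpha> < f y" by (simp add: eventually_at_filter)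
    have "\<forall>\<^sub>F y in nhds x. \<alpha> < f y"
      by (rule eventually_mono[OF *]) (use that in auto)
    then show ?thesis unfolding eventually_nhds by (simp add: subset_eq)
  qed
  then have "open {x. \<alpha> < f x}" by (subst open_subopen) auto
  then show ?thesis by (simp add: closed_def Compl_eq not_le)
qed

text \<open>The last time \<open>c\<close> in the closed set of times at which \<open>f\<close> does not exceed \<open>f (\<xi> a)\<close> would be
  followed by larger values of \<open>f\<close> only. Based at \<open>\<xi> c\<close>, the differential inequality then forces
  the curve to stay put for a while, yet it also demands a strictly negative derivative.\<close>

lemma f_antimono_along_EVI_curve:
  fixes \<xi> :: "real \<Rightarrow> 'a::metric_space"
  assumes f: "\<And>x. f x \<noteq> - \<infinity>" and N: "N < 0"
    and EVI: "EVI_gradient_curve K N f T \<xi>"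
    and lip: "locally_lipschitz_on {t. 0 < t \<and> ereal t < T} \<xi>"
    and lsc: "lower_semicontinuous f"
    and ab: "0 < a" "a \<le> b" "ereal b < T"
  shows "f (\<xi> b) \<le> f (\<xi> a)"
proof (rule ccontr)
  assume not_le: "\<not> f (\<xi> b) \<le> f (\<xi> a)"
  have time: "ereal t < T" if "t \<le> b" for t
    using that ab(3) by (meson ereal_less_eq(3) le_less_trans)
  have fin: "f (\<xi> t) < \<infinity>" if "a \<le> t" "t \<le> b" for t
    using EVI that ab(1) time[of t] by (simp add: EVI_gradient_curve_def)
  have "continuous_on {t. 0 \<le> t \<and> ereal t < T} \<xi>"
    using EVI by (simp add: EVI_gradient_curve_def)
  then have cont: "continuous_on {a..b} \<xi>"
    by (rule continuous_on_subset) (use ab time in auto)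
  define S where "S = {a..b} \<inter> \<xi> -` {x. f x \<le> f (\<xi> a)}"
  have "closed S" unfolding S_def
    by (intro continuous_closed_preimage cont closed_atLeastAtMost
        closed_sublevel_lower_semicontinuous lsc)
  moreover have "bounded S" by (rule bounded_subset[of "{a..b}"]) (auto simp: S_def)
  moreover have "a \<in> S" using ab by (auto simp: S_def)
  ultimately obtain c where c: "c \<in> S" "\<And>t. t \<in> S \<Longrightarrow> t \<le> c"
    using compact_attains_sup[of S] by (auto simp: compact_eq_bounded_closed)
  have c_ab: "a \<le> c" "c < b"
    using c(1) not_le by (auto simp: S_def less_le)
  have above: "f (\<xi> c) < f (\<xi> t)" if "c < t" "t \<le> b" for t
  proof -
    have "f (\<xi> c) \<le> f (\<xi> a)" using c(1) by (simp add: S_def)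
    moreover have "\<not> f (\<xi> t) \<le> f (\<xi> a)"
      using c(2)[of t] that c_ab by (auto simp: S_def)
    ultimately show ?thesis by simp
  qed
  have neg: "ereal (N / 2) * (1 - f_N f N (\<xi> c) / f_N f N (\<xi> t)) < 0" if t: "c < t" "t \<le> b" for t
  proof -
    obtain p where p: "f (\<xi> c) = ereal p" "f_N f N (\<xi> c) = ereal (exp (- p / N))"
      using f_N_finite[of f "\<xi> c" N, OF f fin] N c_ab by auto
    obtain q where q: "f (\<xi> t) = ereal q" "f_N f N (\<xi> t) = ereal (exp (- q / N))"
      using f_N_finite[of f "\<xi> t" N, OF f fin] N c_ab t by auto
    have "p < q" using above[OF t] p q by simp
    then have "- p / N < - q / N" using N by (simp add: divide_strict_right_mono_neg)
    then have "exp (- p / N) / exp (- q / N) < 1" by simp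
    then have "N / 2 * (1 - exp (- p / N) / exp (- q / N)) < 0"
      using N by (intro mult_neg_pos) auto
    then show ?thesis by (simp add: p q one_ereal_def zero_ereal_def del: ereal_eq_1 ereal_eq_0)
  qed
  \<comment> \<open>For \<open>K < 0\<close> the inequality holds only at bounded distance from \<open>\<xi> c\<close>; by continuity this
    restriction is met up to some time \<open>b'\<close> after \<open>c\<close>.\<close>
  define \<rho> where "\<rho> = (if K < 0 then pi * sqrt (N / K) else 1)"
  have "\<rho> > 0" using N by (auto simp: \<rho>_def divide_neg_neg)
  then obtain \<delta> where \<delta>: "\<delta> > 0" "\<And>t. t \<in> {a..b} \<Longrightarrow> dist t c < \<delta> \<Longrightarrow> dist (\<xi> t) (\<xi> c) < \<rho>"
    using cont c_ab unfolding continuous_on_iff by (metis atLeastAtMost_iff less_imp_le)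
  define b' where "b' = min b (c + \<delta> / 2)"
  have b': "c < b'" "b' \<le> b" using c_ab \<delta>(1) by (auto simp: b'_def)
  have near: "dist (\<xi> t) (\<xi> c) < pi * sqrt (N / K)" if "K < 0" "c < t" "t < b'" for t
    using \<delta>(2)[of t] that c_ab by (auto simp: \<rho>_def b'_def dist_real_def)
  let ?u = "\<lambda>t. (s_fun (K / N) (dist (\<xi> t) (\<xi> c) / 2))\<^sup>2"
  have zero: "?u t = 0" if t: "c < t" "t < b'" for t
  proof -
    have "exp (K * t) * ?u t \<le> exp (K * c) * ?u c + 0 * (exp_primitive K t - exp_primitive K c)"
    proof (rule EVI_integrated[OF EVI lip])
      show "ereal (N / 2) * (1 - f_N f N (\<xi> c) / f_N f N (\<xi> r)) \<le> ereal 0" if "c < r" "r < t" for r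
        using neg[of r] that t b' by (auto simp: zero_ereal_def[symmetric] intro: less_imp_le)
    qed (use t b' c_ab ab time[of t] near fin[of c] in auto)
    then have "?u t \<le> 0" by (simp add: mult_le_0_iff)
    then show ?thesis by simp
  qed
  have "\<xi> c \<in> domain_of f" using fin[of c] c_ab by (simp add: domain_of_def)
  then have "AE t in lebesgue.
        0 < t \<and> ereal t < T \<and> (K < 0 \<longrightarrow> dist (\<xi> t) (\<xi> c) < pi * sqrt (N / K)) \<longrightarrow>
        (\<exists>D. (?u has_real_derivative D) (at t) \<and>
             ereal (D + K * ?u t) \<le> ereal (N / 2) * (1 - f_N f N (\<xi> c) / f_N f N (\<xi> t)))"
    using EVI by (auto simp: EVI_gradient_curve_def)
  from AE_lebesgue_obtain[OF this b'(1)] obtain t D where t: "c < t" "t < b'"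
    and D: "(?u has_real_derivative D) (at t)"
    and le: "ereal (D + K * ?u t) \<le> ereal (N / 2) * (1 - f_N f N (\<xi> c) / f_N f N (\<xi> t))"
    using near time b' c_ab ab by (smt (verit))
  have "((\<lambda>_. 0) has_real_derivative D) (at t)"
    by (rule has_field_derivative_transform_within_open[OF D, of "{c<..<b'}"]) (use t zero in auto)
  then have "D = 0" by (rule DERIV_unique) simp
  with le zero[OF t] have "0 \<le> ereal (N / 2) * (1 - f_N f N (\<xi> c) / f_N f N (\<xi> t))"
    by (simp add: zero_ereal_def)
  with neg[of t] t b' show False by auto
qed

section \<open>The two estimates\<close>

text \<open>A supremum of reals bounds the values only if they are bounded above, which holds here because
  the time interval is compact.\<close>

lemma dist_less_if_SUP_less:
  fixes \<xi> :: "real \<Rightarrow> 'a::metric_space"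
  assumes "continuous_on {a..b} \<xi>" "(SUP s\<in>{a..b}. dist (\<xi> s) z) < R" "s \<in> {a..b}"
  shows "dist (\<xi> s) z < R"
proof -
  have "bdd_above ((\<lambda>s. dist (\<xi> s) z) ` {a..b})"
    using assms(1) by (intro bounded_imp_bdd_above compact_imp_bounded compact_continuous_image
        continuous_intros compact_Icc)
  then have "dist (\<xi> s) z \<le> (SUP s\<in>{a..b}. dist (\<xi> s) z)"
    using assms(3) by (rule cSUP_upper[rotated])
  with assms(2) show ?thesis by simp
qed

text \<open>Since \<open>f\<close> does not increase along the curve, \<open>1 / f_N (\<xi> s) \<le> 1 / f_N (\<xi> t)\<close> for \<open>s \<le> t\<close>. Integrating
  over \<open>(0, t)\<close> with the resulting constant gives an inequality between \<open>u 0\<close> and the ratio, once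
  the nonnegative final term is discarded. The factor \<open>w\<close> is the integral of \<open>exp (K s)\<close> over
  \<open>[0, t]\<close>.\<close>

lemma EVI_curve_f_N_ratio_lower_bound:
  fixes \<xi> :: "real \<Rightarrow> 'a::metric_space"
  assumes f: "\<And>x. f x \<noteq> - \<infinity>" and N: "N < 0"
    and EVI: "EVI_gradient_curve K N f T \<xi>"
    and lip: "locally_lipschitz_on {t. 0 < t \<and> ereal t < T} \<xi>"
    and lsc: "lower_semicontinuous f"
    and z: "f z < \<infinity>" and t: "0 < t" "ereal t < T"
    and near: "\<And>s. K < 0 \<Longrightarrow> 0 < s \<Longrightarrow> s < t \<Longrightarrow> dist (\<xi> s) z < pi * sqrt (N / K)"
  shows "ereal (1 + 2 / N * (if K = 0 then 1 / t else K / (exp (K * t) - 1))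
                   * (s_fun (K / N) (dist (\<xi> 0) z / 2))\<^sup>2) \<le> f_N f N z / f_N f N (\<xi> t)"
proof -
  have time: "ereal s < T" if "s \<le> t" for s
    using that t(2) by (meson ereal_less_eq(3) le_less_trans)
  have fin: "f (\<xi> s) < \<infinity>" if "0 < s" "s \<le> t" for s
    using EVI that time[of s] by (simp add: EVI_gradient_curve_def)
  obtain p where p: "f_N f N z = ereal (exp (- p / N))"
    using f_N_finite[of f z N, OF f z] N by auto
  obtain q where q: "f (\<xi> t) = ereal q" "f_N f N (\<xi> t) = ereal (exp (- q / N))"
    using f_N_finite[of f "\<xi> t" N, OF f fin] N t by auto
  define Q where "Q = exp (- p / N) / exp (- q / N)"
  define w where "w = exp_primitive K t - exp_primitive K 0"
  define u where "u = (\<lambda>s. (s_fun (K / N) (dist (\<xi> s) z / 2))\<^sup>2)"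
  have "exp (K * t) * u t \<le> exp (K * 0) * u 0 + N / 2 * (1 - Q) * w"
    unfolding w_def u_def
  proof (rule EVI_integrated[OF EVI lip _ _ t(2) z near])
    fix s assume s: "0 < s" "s < t"
    obtain r where r: "f (\<xi> s) = ereal r" "f_N f N (\<xi> s) = ereal (exp (- r / N))"
      using f_N_finite[of f "\<xi> s" N, OF f fin] N s by auto
    have "f (\<xi> t) \<le> f (\<xi> s)"
      using f_antimono_along_EVI_curve[OF f N EVI lip lsc s(1) _ t(2)] s by simp
    then have "- q / N \<le> - r / N" using r q N by (simp add: divide_right_mono_neg)
    then have "exp (- p / N) / exp (- r / N) \<le> Q" unfolding Q_def
      by (intro divide_left_mono) auto
    then have "N / 2 * (1 - exp (- p / N) / exp (- r / N)) \<le> N / 2 * (1 - Q)"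
      using N by (intro mult_left_mono_neg) auto
    then show "ereal (N / 2) * (1 - f_N f N z / f_N f N (\<xi> s)) \<le> ereal (N / 2 * (1 - Q))"
      by (simp add: p r one_ereal_def del: ereal_eq_1)
  qed (use t in auto)
  moreover have "0 \<le> exp (K * t) * u t" by (simp add: u_def)
  ultimately have le: "0 \<le> u 0 + N / 2 * (1 - Q) * w" by simp
  have w: "(if K = 0 then 1 / t else K / (exp (K * t) - 1)) = 1 / w" "w > 0"
  proof -
    show "(if K = 0 then 1 / t else K / (exp (K * t) - 1)) = 1 / w"
      by (auto simp: w_def exp_primitive_def diff_divide_distrib[symmetric])
    show "w > 0"
    proof (cases "K = 0")
      case False
      then have "w = (exp (K * t) - 1) / K" by (simp add: w_def exp_primitive_def diff_divide_distrib)
      moreover have "(exp (K * t) - 1) / K > 0"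
      proof (cases "K > 0")
        case False
        with \<open>K \<noteq> 0\<close> have "K < 0" by simp
        with t(1) show ?thesis by (intro divide_neg_neg) (simp_all add: mult_neg_pos)
      qed (use t(1) in simp)
      ultimately show ?thesis by simp
    qed (use t in \<open>simp add: w_def exp_primitive_def\<close>)
  qed
  have "1 + 2 / N * (1 / w) * u 0 = (N * w + 2 * u 0) / (N * w)"
    using w(2) N by (simp add: field_simps)
  also have "\<dots> \<le> Q"
  proof (subst neg_divide_le_eq)
    show "N * w < 0" using w(2) N by (simp add: mult_neg_pos)
    show "Q * (N * w) \<le> N * w + 2 * u 0" using le by (simp add: field_simps)
  qed
  finally have "1 + 2 / N * (1 / w) * u 0 \<le> Q" .
  then show ?thesis unfolding w(1) by (simp add: p q Q_def u_def)
qed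

text \<open>Based at \<open>\<xi> t0\<close> the initial term vanishes. As \<open>N < 0\<close>, the right side of the inequality grows
  when \<open>f_N (\<xi> t)\<close> is replaced by the smaller infimum of \<open>f_N\<close>, whose positivity keeps all
  quotients finite.\<close>

lemma EVI_curve_distance_bound:
  fixes \<xi> :: "real \<Rightarrow> 'a::metric_space"
  assumes f: "\<And>x. f x \<noteq> - \<infinity>" and N: "N < 0"
    and EVI: "EVI_gradient_curve K N f T \<xi>"
    and lip: "locally_lipschitz_on {t. 0 < t \<and> ereal t < T} \<xi>"
    and bdd: "bounded_below f"
    and t: "0 < t0" "t0 \<le> t1" "ereal t1 < T"
    and near: "\<And>t. K < 0 \<Longrightarrow> t0 < t \<Longrightarrow> t < t1 \<Longrightarrow> dist (\<xi> t) (\<xi> t0) < pi * sqrt (N / K)"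
  shows "ereal ((s_fun (K / N) (dist (\<xi> t0) (\<xi> t1) / 2))\<^sup>2)
           \<le> ereal (N / 2 * (if K = 0 then t1 - t0 else (1 - exp (K * (t0 - t1))) / K))
              * (1 - f_N f N (\<xi> t0) / (INF x. f_N f N x))"
proof -
  have time: "ereal s < T" if "s \<le> t1" for s
    using that t(3) by (meson ereal_less_eq(3) le_less_trans)
  have fin: "f (\<xi> s) < \<infinity>" if "t0 \<le> s" "s \<le> t1" for s
    using EVI that t(1) time[of s] by (simp add: EVI_gradient_curve_def)
  obtain p where p: "f_N f N (\<xi> t0) = ereal (exp (- p / N))"
    using f_N_finite[of f "\<xi> t0" N, OF f fin] N t by auto
  obtain m where m: "\<And>x. ereal m \<le> f x" using bdd by (auto simp: bounded_below_def)
  have "ereal (exp (- m / N)) \<le> f_N f N x" for x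
    using m[of x] N by (cases "f x") (auto simp: f_N_def divide_right_mono_neg)
  then have lower: "ereal (exp (- m / N)) \<le> (INF x. f_N f N x)" by (intro INF_greatest)
  have upper: "(INF x. f_N f N x) \<le> f_N f N x" for x by (intro INF_lower) simp
  obtain i where i: "(INF x. f_N f N x) = ereal i"
    using lower upper[of "\<xi> t0"] p by (cases "INF x. f_N f N x") auto
  have "i > 0" using lower i by (simp add: less_le_trans[OF exp_gt_zero])
  define C where "C = N / 2 * (1 - exp (- p / N) / i)"
  let ?u = "\<lambda>s. (s_fun (K / N) (dist (\<xi> s) (\<xi> t0) / 2))\<^sup>2"
  have "exp (K * t1) * ?u t1 \<le> exp (K * t0) * ?u t0 + C * (exp_primitive K t1 - exp_primitive K t0)"
  proof (rule EVI_integrated[OF EVI lip _ _ t(3) _ near])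
    fix s assume s: "t0 < s" "s < t1"
    obtain r where r: "f_N f N (\<xi> s) = ereal (exp (- r / N))"
      using f_N_finite[of f "\<xi> s" N, OF f fin] N s by auto
    have "i \<le> exp (- r / N)" using upper[of "\<xi> s"] i r by simp
    then have "exp (- p / N) / exp (- r / N) \<le> exp (- p / N) / i"
      using \<open>i > 0\<close> by (intro divide_left_mono) auto
    then have "N / 2 * (1 - exp (- p / N) / exp (- r / N)) \<le> C"
      unfolding C_def using N by (intro mult_left_mono_neg) auto
    then show "ereal (N / 2) * (1 - f_N f N (\<xi> t0) / f_N f N (\<xi> s)) \<le> ereal C"
      by (simp add: p r one_ereal_def del: ereal_eq_1)
  qed (use t fin[of t0] in auto)
  then have le: "exp (K * t1) * ?u t1 \<le> C * (exp_primitive K t1 - exp_primitive K t0)" by simp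
  have e: "exp (K * t1) * (if K = 0 then t1 - t0 else (1 - exp (K * (t0 - t1))) / K)
             = exp_primitive K t1 - exp_primitive K t0"
    by (auto simp: exp_primitive_def diff_divide_distrib right_diff_distrib exp_diff)
  have "exp (K * t1) * ?u t1
          \<le> exp (K * t1) * (C * (if K = 0 then t1 - t0 else (1 - exp (K * (t0 - t1))) / K))"
    using le e by (simp only: mult.left_commute[of "exp (K * t1)" C])
  then have "?u t1 \<le> C * (if K = 0 then t1 - t0 else (1 - exp (K * (t0 - t1))) / K)"
    by (rule mult_left_le_imp_le) simp
  moreover have "ereal (N / 2 * (if K = 0 then t1 - t0 else (1 - exp (K * (t0 - t1))) / K))
              * (1 - f_N f N (\<xi> t0) / (INF x. f_N f N x))
      = ereal (C * (if K = 0 then t1 - t0 else (1 - exp (K * (t0 - t1))) / K))"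
    using \<open>i > 0\<close> unfolding i p by (simp add: C_def one_ereal_def mult_ac del: ereal_eq_1)
  ultimately show ?thesis by (simp add: dist_commute)
qed

theorem corollary3p7:
  fixes f :: "'a::metric_space \<Rightarrow> ereal" and K N :: real and T :: ereal and \<xi> :: "real \<Rightarrow> 'a"
  assumes f: "\<And>x. f x \<noteq> - \<infinity>"
    and N: "N < 0"
    and T: "0 < T"
    and EVI: "EVI_gradient_curve K N f T \<xi>"
    and lip: "locally_lipschitz_on {t. 0 < t \<and> ereal t < T} \<xi>"
  shows "(lower_semicontinuous f \<longrightarrow>
          (\<forall>z t. f z < \<infinity> \<longrightarrow> 0 < t \<longrightarrow> ereal t < T \<longrightarrow>
             (K < 0 \<longrightarrow> (SUP s\<in>{0..t}. dist (\<xi> s) z) < pi * sqrt (N / K)) \<longrightarrow>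
             f_N f N z / f_N f N (\<xi> t)
               \<ge> ereal (1 + 2 / N * (if K = 0 then 1 / t else K / (exp (K * t) - 1))
                              * (s_fun (K / N) (dist (\<xi> 0) z / 2))\<^sup>2)))
       \<and> (bounded_below f \<longrightarrow>
          (\<forall>t0 t1. 0 < t0 \<longrightarrow> t0 \<le> t1 \<longrightarrow> ereal t1 < T \<longrightarrow>
             (K < 0 \<longrightarrow> (SUP t\<in>{t0..t1}. dist (\<xi> t) (\<xi> t0)) < pi * sqrt (N / K)) \<longrightarrow>
             ereal ((s_fun (K / N) (dist (\<xi> t0) (\<xi> t1) / 2))\<^sup>2)
               \<le> ereal (N / 2 * (if K = 0 then t1 - t0 else (1 - exp (K * (t0 - t1))) / K))
                  * (1 - f_N f N (\<xi> t0) / (INF x. f_N f N x))))"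
proof (intro conjI impI allI)
  have "continuous_on {t. 0 \<le> t \<and> ereal t < T} \<xi>"
    using EVI by (simp add: EVI_gradient_curve_def)
  then have cont: "continuous_on {a..b} \<xi>" if "0 \<le> a" "ereal b < T" for a b
    by (rule continuous_on_subset)
       (use that in \<open>auto intro: le_less_trans[of "ereal _" "ereal b" T]\<close>)
  show "ereal (1 + 2 / N * (if K = 0 then 1 / t else K / (exp (K * t) - 1))
                   * (s_fun (K / N) (dist (\<xi> 0) z / 2))\<^sup>2) \<le> f_N f N z / f_N f N (\<xi> t)"
    if "lower_semicontinuous f" "f z < \<infinity>" "0 < t" "ereal t < T"
      and sup: "K < 0 \<longrightarrow> (SUP s\<in>{0..t}. dist (\<xi> s) z) < pi * sqrt (N / K)" for z t
    using EVI_curve_f_N_ratio_lower_bound[OF f N EVI lip that(1-4)]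
      dist_less_if_SUP_less[OF cont[OF order_refl that(4)] sup[rule_format]]
    by simp
  show "ereal ((s_fun (K / N) (dist (\<xi> t0) (\<xi> t1) / 2))\<^sup>2)
           \<le> ereal (N / 2 * (if K = 0 then t1 - t0 else (1 - exp (K * (t0 - t1))) / K))
              * (1 - f_N f N (\<xi> t0) / (INF x. f_N f N x))"
    if "bounded_below f" "0 < t0" "t0 \<le> t1" "ereal t1 < T"
      and sup: "K < 0 \<longrightarrow> (SUP t\<in>{t0..t1}. dist (\<xi> t) (\<xi> t0)) < pi * sqrt (N / K)" for t0 t1
    using EVI_curve_distance_bound[OF f N EVI lip that(1-4)]
      dist_less_if_SUP_less[OF cont[OF less_imp_le[OF that(2)] that(4)] sup[rule_format]]
    by simp
qed

end
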